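(* Let $K$ be a field of characteristic $p>0$, complete with respect to a nontrivial absolute value $|\cdot|$, and let $\lambda\in K$, $|\lambda|=1$, but not a root of unity. Then convergent power series of the form \[ f(x)=\lambda x+\sum_{i\ge 2,\ p\mid i}a_ix^i\in K[[x]] \] are linearizable at the origin.
   Context: A convergent power series is one with positive radius of convergence. A power series $f(x)=\lambda x+\sum_{i\ge2}a_ix^i\in K[[x]]$ with $|\lambda|=1$ is (analytically) linearizable at the origin if there is a power series $g\in K[[x]]$ with $g(0)=0$, $g'(0)=1$ and positive radius of convergence solving the Schröder functional equation $g\circ f(x)=\lambda g(x)$. *)

theory Defs
  imports "HOL-Analysis.Analysis"
begin

locale absolute_value =
  fixes v :: "'a::field \<Rightarrow> real"
  assumes nonneg: "0 \<le> v x"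
    and eq_0_iff: "v x = 0 \<longleftrightarrow> x = 0"
    and mult: "v (x * y) = v x * v y"
    and triangle: "v (x + y) \<le> v x + v y"

definition nontrivial_value :: "('a::field \<Rightarrow> real) \<Rightarrow> bool" where
  "nontrivial_value v \<longleftrightarrow> (\<exists>x. x \<noteq> 0 \<and> v x \<noteq> 1)"

context absolute_value
begin

lemma one: "v 1 = 1"
  using mult[of 1 1] eq_0_iff[of 1] by simp

lemma uminus: "v (- x) = v x"
proof -
  have "v (- 1) * v (- 1) = 1"
    using mult[of "- 1" "- 1"] one by simp
  then have "v (- 1) = 1"
    using nonneg[of "- 1"] square_eq_1_iff[of "v (- 1)"] by auto
  then show ?thesis
    using mult[of "- 1" x] by simp
qed

lemma Metric_space_value: "Metric_space UNIV (\<lambda>x y. v (x - y))"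
proof
  fix x y z :: 'a
  show "0 \<le> v (x - y)" by (rule nonneg)
  show "v (x - y) = v (y - x)" using uminus[of "x - y"] by simp
  show "v (x - y) = 0 \<longleftrightarrow> x = y" by (simp add: eq_0_iff)
  show "v (x - z) \<le> v (x - y) + v (y - z)" using triangle[of "x - y" "y - z"] by simp
qed

end

definition complete_value :: "('a::field \<Rightarrow> real) \<Rightarrow> bool" where
  "complete_value v \<longleftrightarrow> Metric_space.mcomplete UNIV (\<lambda>x y. v (x - y))"

text \<open>
  The radius of convergence is given by the Cauchy--Hadamard formula
  \<open>1 / limsup root n (v a\<^sub>n)\<close>. The library's \<^const>\<open>conv_radius\<close>
  needs coefficients in a real Banach space, so it is applied to the real
  sequence of the absolute values of the coefficients.
\<close>
definition radius_of_convergence :: "('a::field \<Rightarrow> real) \<Rightarrow> 'a fps \<Rightarrow> ereal" where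
  "radius_of_convergence v f = conv_radius (\<lambda>n. v (fps_nth f n))"

definition convergent_fps :: "('a::field \<Rightarrow> real) \<Rightarrow> 'a fps \<Rightarrow> bool" where
  "convergent_fps v f \<longleftrightarrow> radius_of_convergence v f > 0"

text \<open>
  Meant for \<open>f\<close> with zero constant term, so that the formal composition is the
  genuine one. The multiplier is the linear coefficient of \<open>f\<close>.
\<close>
definition linearizable :: "('a::field \<Rightarrow> real) \<Rightarrow> 'a fps \<Rightarrow> bool" where
  "linearizable v f \<longleftrightarrow>
     (\<exists>g. fps_nth g 0 = 0 \<and> fps_nth g 1 = 1 \<and> convergent_fps v g \<and>
          fps_compose g f = fps_const (fps_nth f 1) * g)"

end

theory Submission
  imports Defs
begin

text \<open>
  Since \<^term>\<open>f - fps_const lam * fps_X\<close> is a series in \<^term>\<open>fps_X ^ p\<close>, the derivative of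
  \<open>f\<close> is the constant \<open>\<lambda>\<close>. Differentiating the Schroeder equation therefore gives
  \<open>g' \<circ> f = g'\<close>, which forces \<open>g' = 1\<close>: apart from its linear term, the conjugacy \<open>g\<close> has to be a
  series in the \<open>p\<close>-th power of the variable as well. Conversely, a \<open>g\<close> with this support is
  determined by the equation's coefficients of index divisible by \<open>p\<close>
  (\<open>schroeder_coeff\<close>), and the remaining coefficients of the equation hold automatically, because
  for \<open>p dvd l\<close> the power \<open>f ^ l\<close> has derivative \<open>0\<close> and hence only terms of degree divisible
  by \<open>p\<close> (\<open>fps_power_nth_eq_0_if_CHAR_dvd\<close>).

  The small divisors that occur are thus only \<open>\<lambda> - \<lambda>\<^sup>k\<close> with \<open>p dvd k\<close>, of the
  same size as \<open>1 - \<lambda>\<^sup>n\<close> with \<open>n = k - 1\<close> prime to \<open>p\<close>. The divisors that become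
  arbitrarily small are those with \<open>n\<close> divisible by high powers of \<open>p\<close>; for \<open>n\<close> prime to \<open>p\<close>
  there is a uniform lower bound \<open>\<delta> > 0\<close> (\<open>value_power_diff_1_bounded_below\<close>). The Frobenius
  homomorphism makes the absolute value ultrametric, and then a single \<open>\<delta>\<close> suffices
  even though divisors accumulate along the recursion: if the coefficients of \<open>f\<close> satisfy
  \<open>v (a\<^sub>i) \<le> A ^ (i - 1)\<close>, then the coefficient of index \<open>k\<close> in \<open>f ^ l\<close> is bounded by
  \<open>A ^ (k - l)\<close>, and each step of the recursion for \<open>g\<close>, which loses one factor \<open>1 / \<delta>\<close>, raises the
  degree by at least one. So the coefficients of \<open>g\<close> are bounded by \<open>(A / \<delta>) ^ (k - 1)\<close>.
\<close>

unbundle no vec_syntax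
unbundle fps_syntax

section \<open>Absolute values on fields of prime characteristic\<close>

context absolute_value
begin

lemma zero: "v 0 = 0"
  by (simp add: eq_0_iff)

lemma pos_iff: "0 < v x \<longleftrightarrow> x \<noteq> 0"
  using nonneg[of x] eq_0_iff[of x] by linarith

lemma power: "v (x ^ n) = v x ^ n"
  by (induction n) (simp_all add: one mult)

text \<open>
  Applying the triangle inequality to \<open>x ^ q + y ^ q = (x + y) ^ q\<close> for \<open>q = p ^ n\<close> gives
  \<open>v (x + y) ^ q \<le> 2 * max (v x) (v y) ^ q\<close>, and the factor \<open>2\<close> is lost as \<open>q\<close> grows.
\<close>
lemma ultrametric:
  assumes "CHAR('a) > 0"
  shows "v (x + y) \<le> max (v x) (v y)"
proof (rule ccontr)
  define M where "M = max (v x) (v y)"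
  assume "\<not> v (x + y) \<le> max (v x) (v y)"
  then have less: "M < v (x + y)"
    by (auto simp: M_def)
  have M_pos: "0 < M"
  proof (rule ccontr)
    assume "\<not> 0 < M"
    then have "v x = 0" "v y = 0"
      using nonneg[of x] nonneg[of y] by (auto simp: M_def)
    with less show False
      by (simp add: eq_0_iff zero M_def)
  qed
  have p: "prime CHAR('a)"
    using assms by (rule prime_CHAR_semidom)
  have bound: "(v (x + y) / M) ^ (CHAR('a) ^ n) \<le> 2" for n
  proof -
    let ?q = "CHAR('a) ^ n"
    have "v (x + y) ^ ?q = v (x ^ ?q + y ^ ?q)"
      by (simp flip: power freshmans_dream'[OF p refl])
    also have "\<dots> \<le> v x ^ ?q + v y ^ ?q"
      using triangle[of "x ^ ?q" "y ^ ?q"] by (simp add: power)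
    also have "\<dots> \<le> M ^ ?q + M ^ ?q"
      by (intro add_mono power_mono) (auto simp: M_def nonneg)
    finally show ?thesis
      using M_pos by (simp add: power_divide field_simps)
  qed
  have gt1: "1 < v (x + y) / M"
    using less M_pos by simp
  then obtain n where n: "2 < (v (x + y) / M) ^ n"
    using real_arch_pow by blast
  have "n \<le> CHAR('a) ^ n"
    using prime_gt_1_nat[OF p] by (simp add: less_imp_le)
  then have "(v (x + y) / M) ^ n \<le> (v (x + y) / M) ^ (CHAR('a) ^ n)"
    using gt1 by (intro power_increasing) auto
  with n bound[of n] show False
    by linarith
qed

lemma ultrametric_diff:
  assumes "CHAR('a) > 0"
  shows "v (x - y) \<le> max (v x) (v y)"
  using ultrametric[OF assms, of x "- y"] by (simp add: uminus)

lemma ultrametric_sum: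
  assumes "CHAR('a) > 0" and "0 \<le> M" and "\<And>i. i \<in> I \<Longrightarrow> v (h i) \<le> M"
  shows "v (sum h I) \<le> M"
  using assms(3)
proof (induction I rule: infinite_finite_induct)
  case (insert i I)
  then have "v (h i) \<le> M" "v (sum h I) \<le> M"
    by simp_all
  then show ?case
    using ultrametric[OF assms(1), of "h i" "sum h I"] insert.hyps by simp
qed (use assms(2) in \<open>simp_all add: zero\<close>)

lemma value_of_nat_le_1:
  assumes "CHAR('a) > 0"
  shows "v (of_nat n) \<le> 1"
proof -
  have "v (\<Sum>i<n. 1) \<le> 1"
    by (rule ultrametric_sum[OF assms]) (simp_all add: one)
  then show ?thesis
    by simp
qed

text \<open>An integer prime to the characteristic is inverted by another integer.\<close>
lemma value_of_nat_eq_1: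
  assumes "CHAR('a) > 0" and "\<not> CHAR('a) dvd n"
  shows "v (of_nat n) = 1"
proof -
  have "coprime n CHAR('a)"
    using prime_imp_coprime[OF prime_CHAR_semidom[OF assms(1)] assms(2)]
    by (simp add: coprime_commute)
  moreover have "n \<noteq> 0"
    using assms(2) by (metis dvd_0_right)
  ultimately obtain m k where "n * m = CHAR('a) * k + 1"
    using bezout_nat[of n "CHAR('a)"] by (auto simp: coprime_iff_gcd_eq_1)
  then have "of_nat (n * m) = (1 :: 'a)"
    by simp
  then have "v (of_nat n) * v (of_nat m) = 1"
    by (simp add: one flip: mult)
  moreover have "v (of_nat n) * v (of_nat m) \<le> v (of_nat n) * 1"
    by (intro mult_left_mono nonneg value_of_nat_le_1 assms(1))
  ultimately show ?thesis
    using value_of_nat_le_1[OF assms(1), of n] by linarith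
qed

section \<open>Small divisors\<close>

lemma value_geometric_sum_le_1:
  assumes "CHAR('a) > 0" and "v x \<le> 1"
  shows "v (\<Sum>i<n. x ^ i) \<le> 1"
  using assms by (intro ultrametric_sum) (simp_all add: power power_le_one nonneg)

lemma value_power_diff_1_le:
  assumes "CHAR('a) > 0" and "v x \<le> 1"
  shows "v (x ^ n - 1) \<le> v (x - 1)"
proof -
  have "v (x - 1) * v (\<Sum>i<n. x ^ i) \<le> v (x - 1) * 1"
    by (intro mult_left_mono nonneg value_geometric_sum_le_1 assms)
  then show ?thesis
    by (simp add: power_diff_1_eq mult)
qed

text \<open>
  In \<open>x ^ n - 1 = (x - 1) * (1 + x + \<dots> + x ^ (n - 1))\<close> the second factor is congruent to \<open>n\<close>
  modulo the maximal ideal of the valuation ring, so it is a unit there.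
\<close>
lemma value_power_diff_1_eq:
  assumes "CHAR('a) > 0" and "v (x - 1) < 1" and "\<not> CHAR('a) dvd n"
  shows "v (x ^ n - 1) = v (x - 1)"
proof -
  have x: "v x \<le> 1"
    using ultrametric[OF assms(1), of "x - 1" 1] assms(2) by (simp add: one)
  have "v (\<Sum>i<n. x ^ i - 1) \<le> v (x - 1)"
    by (intro ultrametric_sum value_power_diff_1_le assms(1) x nonneg)
  then have small: "v ((\<Sum>i<n. x ^ i) - of_nat n) < 1"
    using assms(2) by (simp add: sum_subtractf)
  have "v (of_nat n) \<le> max (v (\<Sum>i<n. x ^ i)) (v ((\<Sum>i<n. x ^ i) - of_nat n))"
    using ultrametric_diff[OF assms(1), of "\<Sum>i<n. x ^ i" "(\<Sum>i<n. x ^ i) - of_nat n"] by simp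
  with small have "1 \<le> v (\<Sum>i<n. x ^ i)"
    using value_of_nat_eq_1[OF assms(1,3)] by (simp add: le_max_iff_disj)
  moreover have "v (\<Sum>i<n. x ^ i) \<le> 1"
    using assms(1) x by (rule value_geometric_sum_le_1)
  ultimately show ?thesis
    by (simp add: power_diff_1_eq mult)
qed

text \<open>
  If \<open>m\<close> and \<open>n\<close> are exponents prime to the characteristic whose divisors \<open>x ^ m - 1\<close> and
  \<open>x ^ n - 1\<close> both have value below \<open>1\<close>, then both values equal that of \<open>x ^ (m * n) - 1\<close>. So
  the divisors with such exponents take at most one value below \<open>1\<close>.
\<close>
lemma value_power_diff_1_bounded_below:
  assumes "CHAR('a) > 0" and "\<forall>n>0. x ^ n \<noteq> 1"
  obtains \<delta> where "0 < \<delta>" "\<delta> \<le> 1" "\<And>n. \<not> CHAR('a) dvd n \<Longrightarrow> \<delta> \<le> v (x ^ n - 1)"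
proof (cases "\<exists>m. \<not> CHAR('a) dvd m \<and> v (x ^ m - 1) < 1")
  case True
  then obtain m where m: "\<not> CHAR('a) dvd m" "v (x ^ m - 1) < 1"
    by blast
  have "m > 0"
    using m(1) by (cases m) auto
  show thesis
  proof
    show "0 < v (x ^ m - 1)"
      using assms(2) \<open>m > 0\<close> by (simp add: pos_iff)
    show "v (x ^ m - 1) \<le> 1"
      using m(2) by simp
    show "v (x ^ m - 1) \<le> v (x ^ n - 1)" if n: "\<not> CHAR('a) dvd n" for n
    proof (cases "v (x ^ n - 1) < 1")
      case True
      have "v (x ^ m - 1) = v ((x ^ m) ^ n - 1)"
        by (rule value_power_diff_1_eq[OF assms(1) m(2) n, symmetric])
      also have "(x ^ m) ^ n = (x ^ n) ^ m"
        by (simp add: mult.commute flip: power_mult)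
      also have "v ((x ^ n) ^ m - 1) = v (x ^ n - 1)"
        by (rule value_power_diff_1_eq[OF assms(1) True m(1)])
      finally show ?thesis
        by simp
    qed (use m(2) in simp)
  qed
next
  case False
  then show thesis
    by (intro that[of 1]) (auto simp: not_less)
qed

section \<open>Coefficient bounds for power series\<close>

text \<open>
  The hypotheses say that the weighted Gauss norms \<open>sup\<^sub>n v (f $ n) / A ^ n\<close> of the two factors
  are at most \<open>1 / C\<close> and \<open>1 / D\<close>; this norm is submultiplicative.
\<close>
lemma fps_mult_nth_bound:
  fixes f g :: "'a fps"
  assumes "CHAR('a) > 0" and "0 \<le> A" and "0 < C" and "0 < D"
    and "\<And>n. v (f $ n) * C \<le> A ^ n" and "\<And>n. v (g $ n) * D \<le> A ^ n"
  shows "v ((f * g) $ n) * (C * D) \<le> A ^ n"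
proof -
  have "v (f $ i * g $ (n - i)) \<le> A ^ n / (C * D)" if "i \<in> {0..n}" for i
  proof -
    have "(v (f $ i) * C) * (v (g $ (n - i)) * D) \<le> A ^ i * A ^ (n - i)"
      using assms by (intro mult_mono) (simp_all add: nonneg)
    also have "\<dots> = A ^ n"
      using that by (simp flip: power_add)
    finally show ?thesis
      using assms(3,4) by (simp add: mult field_simps)
  qed
  then have "v ((f * g) $ n) \<le> A ^ n / (C * D)"
    unfolding fps_mult_nth using assms by (intro ultrametric_sum) simp_all
  then show ?thesis
    using assms(3,4) by (simp add: field_simps)
qed

text \<open>
  With \<open>A\<close> in place of \<open>C\<close>, the bound reads \<open>v (f ^ l $ n) \<le> A ^ (n - l)\<close> for \<open>l \<le> n\<close>; writing it
  as a product avoids the truncated subtraction.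
\<close>
lemma fps_power_nth_bound:
  fixes f :: "'a fps"
  assumes "CHAR('a) > 0" and "0 \<le> A" and "0 < C" and "\<And>n. v (f $ n) * C \<le> A ^ n"
  shows "v (f ^ l $ n) * C ^ l \<le> A ^ n"
proof (induction l arbitrary: n)
  case 0
  show ?case
    using assms(2) by (simp add: one zero)
next
  case (Suc l)
  show ?case
    using fps_mult_nth_bound[OF assms(1-3) zero_less_power[OF assms(3)] assms(4) Suc.IH] by simp
qed

lemma convergent_fpsI:
  assumes "0 < A" and "\<And>n. v (f $ n) \<le> A ^ n"
  shows "convergent_fps v f"
proof -
  let ?r = "1 / (2 * A)"
  have "summable (\<lambda>n. v (f $ n) * ?r ^ n)"
  proof (rule summable_comparison_test')
    show "summable (\<lambda>n. (1 / 2 :: real) ^ n)"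
      by (simp add: summable_geometric)
    fix n :: nat
    have "v (f $ n) * ?r ^ n \<le> A ^ n * ?r ^ n"
      using assms by (intro mult_right_mono) simp_all
    also have "\<dots> = (1 / 2) ^ n"
      using assms(1) by (simp flip: power_mult_distrib)
    finally show "norm (v (f $ n) * ?r ^ n) \<le> (1 / 2) ^ n"
      using assms(1) by (simp add: nonneg)
  qed
  then have "ereal (norm ?r) \<le> radius_of_convergence v f"
    unfolding radius_of_convergence_def by (rule conv_radius_geI)
  moreover have "0 < ereal (norm ?r)"
    using assms(1) by simp
  ultimately show ?thesis
    unfolding convergent_fps_def by (rule order.strict_trans2[rotated])
qed

text \<open>
  Cauchy's estimate gives \<open>v (f $ n) \<le> C / r ^ n\<close>. A constant \<open>C\<close> on the right can be absorbed
  in the base of the power, at the price of making the base larger, for all \<open>n \<ge> 2\<close>; for \<open>n = 1\<close> the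
  bound wanted here is \<open>v (f $ 1) \<le> 1\<close>, which no choice of base can provide.
\<close>
lemma convergent_fps_bound:
  assumes "convergent_fps v f" and "f $ 0 = 0" and "v (f $ 1) \<le> 1"
  obtains A where "1 \<le> A" "\<And>n. v (f $ n) * A \<le> A ^ n"
proof -
  have "0 < conv_radius (\<lambda>n. v (f $ n))"
    using assms(1) by (simp add: convergent_fps_def radius_of_convergence_def)
  then have "0 < min 1 (conv_radius (\<lambda>n. v (f $ n)))"
    by simp
  then obtain r where "0 < ereal r" "ereal r < min 1 (conv_radius (\<lambda>n. v (f $ n)))"
    by (rule ereal_dense2[THEN exE]) blast
  then have r: "0 < r" "r < 1" "ereal (norm r) < conv_radius (\<lambda>n. v (f $ n))"
    by simp_all
  then have "summable (\<lambda>n. v (f $ n) * r ^ n)"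
    by (intro summable_in_conv_radius)
  then have "Bseq (\<lambda>n. v (f $ n) * r ^ n)"
    by (intro convergent_imp_Bseq) (metis summable_LIMSEQ_zero convergentI)
  then obtain C where C: "\<And>n. v (f $ n) * r ^ n \<le> C"
    by (auto simp: Bseq_def abs_le_iff)
  define D where "D = max 1 C"
  \<comment> \<open>The square makes \<open>A ^ (n - 1)\<close> contain \<open>1 / r ^ (2 * (n - 1))\<close>, and \<open>2 * (n - 1) \<ge> n\<close> for \<open>n \<ge> 2\<close>.\<close>
  define A where "A = D / r\<^sup>2"
  have D: "1 \<le> D" "C \<le> D"
    by (simp_all add: D_def)
  have "r\<^sup>2 \<le> 1"
    using r by (simp add: power_le_one)
  then have A: "1 \<le> A"
    using r D by (simp add: A_def field_simps)
  show thesis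
  proof
    show "1 \<le> A" by (rule A)
    show "v (f $ n) * A \<le> A ^ n" for n
    proof -
      consider "n = 0" | "n = 1" | m where "n = m + 2"
        by (metis One_nat_def add_2_eq_Suc' not0_implies_Suc)
      then show ?thesis
      proof cases
        case 1
        then show ?thesis using assms(2) by (simp add: zero)
      next
        case 2
        then show ?thesis using assms(3) A mult_right_mono[of "v (f $ 1)" 1 A] by simp
      next
        case 3
        have "v (f $ n) \<le> D / r ^ n"
          using C[of n] D r by (simp add: field_simps)
        also have "\<dots> \<le> D ^ (m + 1) / r ^ (2 * (m + 1))"
          using r D 3 by (intro frac_le power_decreasing self_le_power) simp_all
        also have "\<dots> = A ^ (m + 1)"
          by (simp only: A_def power_divide power_mult)
        finally have "v (f $ n) * A \<le> A ^ (m + 1) * A"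
          using A by (intro mult_right_mono) simp_all
        then show ?thesis
          using 3 by (simp add: mult_ac)
      qed
    qed
  qed
qed

end

section \<open>Formal solution of the Schroeder equation\<close>

text \<open>
  The power \<open>f ^ l\<close> has derivative \<open>0\<close>, as the exponent vanishes in the field; so \<open>k\<close> times its
  coefficient of index \<open>k\<close> is \<open>0\<close>, and \<open>k\<close> is invertible in the field.
\<close>
lemma fps_power_nth_eq_0_if_CHAR_dvd:
  fixes f :: "'a::field fps"
  assumes "CHAR('a) dvd l" and "\<not> CHAR('a) dvd k"
  shows "f ^ l $ k = 0"
proof -
  have "k \<noteq> 0"
    using assms(2) by (metis dvd_0_right)
  have "fps_deriv (f ^ l) = 0"
    using assms(1) by (simp add: fps_deriv_power of_nat_eq_0_iff_char_dvd)
  then have "fps_deriv (f ^ l) $ (k - 1) = 0"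
    by simp
  then have "of_nat k * f ^ l $ k = 0"
    using \<open>k \<noteq> 0\<close> by (simp del: of_nat_Suc)
  then show ?thesis
    using assms(2) by (simp add: of_nat_eq_0_iff_char_dvd)
qed

text \<open>
  The quotient solves for the coefficient of index \<open>k\<close> in \<open>g \<circ> f = (f $ 1) * g\<close>. At \<open>k = 0\<close> the
  sum is empty, so the value is the required \<open>0\<close>.
\<close>
fun schroeder_coeff :: "'a::field fps \<Rightarrow> nat \<Rightarrow> 'a" where
  "schroeder_coeff f k =
     (if k = 1 then 1
      else if CHAR('a) dvd k
        then (\<Sum>l<k. schroeder_coeff f l * f ^ l $ k) / (f $ 1 - (f $ 1) ^ k)
      else 0)"

declare schroeder_coeff.simps [simp del]

lemma schroeder_coeff_0 [simp]: "schroeder_coeff f 0 = 0"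
  by (subst schroeder_coeff.simps) simp

lemma schroeder_coeff_1 [simp]: "schroeder_coeff f (Suc 0) = 1"
  by (subst schroeder_coeff.simps) simp

lemma schroeder_coeff_eq_0:
  fixes f :: "'a::field fps"
  assumes "k \<noteq> 1" and "\<not> CHAR('a) dvd k"
  shows "schroeder_coeff f k = 0"
  using assms by (subst schroeder_coeff.simps) simp

lemma schroeder_coeff_recursion:
  fixes f :: "'a::field fps"
  assumes "\<forall>n>0. (f $ 1) ^ n \<noteq> 1" and "f $ 1 \<noteq> 0"
    and "\<forall>i\<ge>2. \<not> CHAR('a) dvd i \<longrightarrow> f $ i = 0" and "k \<noteq> 1"
  shows "schroeder_coeff f k * (f $ 1 - (f $ 1) ^ k) = (\<Sum>l<k. schroeder_coeff f l * f ^ l $ k)"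
proof (cases "CHAR('a) dvd k")
  case True
  show ?thesis
  proof (cases k)
    case (Suc n)
    with assms(4) have "n > 0" by simp
    then have "f $ 1 - (f $ 1) ^ k \<noteq> 0"
      using assms(1,2) Suc by simp
    then show ?thesis
      using True assms(4) by (subst schroeder_coeff.simps) simp
  qed simp
next
  case False
  have "schroeder_coeff f l * f ^ l $ k = 0" if "l < k" for l
  proof (cases "l = 1")
    case True
    then show ?thesis using assms(3) False that by simp
  next
    case l: False
    show ?thesis
    proof (cases "CHAR('a) dvd l")
      case True
      then show ?thesis using False by (simp add: fps_power_nth_eq_0_if_CHAR_dvd)
    next
      case False
      with l show ?thesis by (simp add: schroeder_coeff_eq_0)
    qed
  qed
  then have "(\<Sum>l<k. schroeder_coeff f l * f ^ l $ k) = 0"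
    by (intro sum.neutral) auto
  then show ?thesis
    using False assms(4) by (simp add: schroeder_coeff_eq_0)
qed

lemma schroeder_equation:
  fixes f :: "'a::field fps"
  assumes "\<forall>n>0. (f $ 1) ^ n \<noteq> 1" and "f $ 1 \<noteq> 0" and "f $ 0 = 0"
    and "\<forall>i\<ge>2. \<not> CHAR('a) dvd i \<longrightarrow> f $ i = 0"
  shows "fps_compose (Abs_fps (schroeder_coeff f)) f =
           fps_const (f $ 1) * Abs_fps (schroeder_coeff f)"
proof (rule fps_ext)
  fix k
  let ?b = "schroeder_coeff f"
  have "fps_compose (Abs_fps ?b) f $ k = (\<Sum>l<k. ?b l * f ^ l $ k) + ?b k * f ^ k $ k"
    by (simp add: fps_compose_nth atLeast0AtMost flip: lessThan_Suc_atMost)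
  also have "f ^ k $ k = (f $ 1) ^ k"
    using assms(3) by (rule startsby_zero_power_nth_same)
  also have "(\<Sum>l<k. ?b l * f ^ l $ k) + ?b k * (f $ 1) ^ k = f $ 1 * ?b k"
  proof (cases "k = 1")
    case False
    show ?thesis
      unfolding schroeder_coeff_recursion[OF assms(1,2,4) False, symmetric]
      by (simp add: algebra_simps)
  qed simp
  finally show "fps_compose (Abs_fps ?b) f $ k = (fps_const (f $ 1) * Abs_fps ?b) $ k"
    by simp
qed

section \<open>Convergence of the conjugacy\<close>

text \<open>
  In the recursion the coefficient of index \<open>l < k\<close> is multiplied by one of size at most
  \<open>A ^ (k - l) = (\<delta> * B) ^ (k - l) \<le> \<delta> * B ^ (k - l)\<close> with \<open>B = A / \<delta>\<close>, and the factor \<open>\<delta>\<close> gained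
  here pays for the division by \<open>f $ 1 - (f $ 1) ^ k\<close>.
\<close>
lemma (in absolute_value) schroeder_coeff_bound:
  fixes f :: "'a fps"
  assumes "CHAR('a) > 0" and "v (f $ 1) = 1" and "1 \<le> A" and "0 < \<delta>" and "\<delta> \<le> 1"
    and f: "\<And>n. v (f $ n) * A \<le> A ^ n"
    and divisors: "\<And>n. \<not> CHAR('a) dvd n \<Longrightarrow> \<delta> \<le> v ((f $ 1) ^ n - 1)"
  shows "v (schroeder_coeff f k) * (A / \<delta>) \<le> (A / \<delta>) ^ k"
proof (induction k rule: less_induct)
  case (less k)
  let ?b = "schroeder_coeff f" and ?B = "A / \<delta>"
  have B: "1 \<le> ?B"
    using assms by (simp add: field_simps)
  show ?case
  proof (cases "k = 0 \<or> k = 1 \<or> \<not> CHAR('a) dvd k")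
    case True
    then show ?thesis
      using B by (cases "k = 1") (auto simp: one zero schroeder_coeff_eq_0)
  next
    case False
    define d where "d = f $ 1 - (f $ 1) ^ k"
    obtain n where n: "k = Suc n"
      using False by (cases k) auto
    have "\<not> CHAR('a) dvd n"
      using False n prime_CHAR_semidom[OF assms(1)]
      by (metis Suc_eq_plus1 dvd_add_right_iff nat_dvd_1_iff_1 not_prime_1)
    then have "\<delta> \<le> v ((f $ 1) ^ n - 1)"
      by (rule divisors)
    also have "\<dots> = v (f $ 1 * (1 - (f $ 1) ^ n))"
      using uminus[of "1 - (f $ 1) ^ n"] assms(2) by (simp add: mult)
    also have "f $ 1 * (1 - (f $ 1) ^ n) = d"
      by (simp add: d_def n algebra_simps)
    finally have d: "\<delta> \<le> v d" .
    have term_bound: "v (?b l * f ^ l $ k) \<le> \<delta> * ?B ^ k / ?B" if "l < k" for l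
    proof -
      have "v (f ^ l $ k) * A ^ l \<le> A ^ k"
        using assms by (intro fps_power_nth_bound) simp_all
      also have "A ^ k = A ^ (k - l) * A ^ l"
        using that by (simp flip: power_add)
      finally have "v (f ^ l $ k) \<le> A ^ (k - l)"
        using assms(3) by simp
      also have "\<dots> = \<delta> ^ (k - l) * ?B ^ (k - l)"
        using assms(4) by (simp flip: power_mult_distrib)
      also have "\<dots> \<le> \<delta> * ?B ^ (k - l)"
        using assms(4,5) B that power_decreasing[of 1 "k - l" \<delta>] by (intro mult_right_mono) simp_all
      finally have "(v (?b l) * ?B) * v (f ^ l $ k) \<le> ?B ^ l * (\<delta> * ?B ^ (k - l))"
        using B by (intro mult_mono less.IH that) (simp_all add: nonneg)
      also have "\<dots> = \<delta> * ?B ^ k"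
        using that by (simp add: mult.left_commute flip: power_add)
      finally have "v (?b l * f ^ l $ k) * ?B \<le> \<delta> * ?B ^ k"
        by (simp add: mult ac_simps)
      then show ?thesis
        using B by (subst pos_le_divide_eq) simp_all
    qed
    have "?b k * d = (\<Sum>l<k. ?b l * f ^ l $ k)"
      using False d assms(4) eq_0_iff[of d] unfolding d_def
      by (subst schroeder_coeff.simps) auto
    then have "v (?b k) * v d = v (\<Sum>l<k. ?b l * f ^ l $ k)"
      by (simp flip: mult)
    also have "\<dots> \<le> \<delta> * ?B ^ k / ?B"
      using assms B term_bound by (intro ultrametric_sum) simp_all
    finally have "v (?b k) * v d \<le> \<delta> * ?B ^ k / ?B" .
    moreover have "v (?b k) * \<delta> \<le> v (?b k) * v d"
      using d by (intro mult_left_mono nonneg)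
    ultimately have "\<delta> * v (?b k) \<le> \<delta> * (?B ^ k / ?B)"
      by (simp only: mult.commute times_divide_eq_right)
    then have "v (?b k) \<le> ?B ^ k / ?B"
      using assms(4) by (simp only: mult_le_cancel_left_pos)
    then show ?thesis
      using B by (subst (asm) pos_le_divide_eq) simp_all
  qed
qed

theorem theorem3:
  fixes v :: "'a::field \<Rightarrow> real" and p :: nat and lam :: 'a and f :: "'a fps"
  assumes "p > 0" and "CHAR('a) = p"
    and "absolute_value v" and "nontrivial_value v" and "complete_value v"
    and "v lam = 1" and "\<forall>n>0. lam ^ n \<noteq> 1"
    and "fps_nth f 0 = 0" and "fps_nth f 1 = lam"
    and "\<forall>i\<ge>2. \<not> p dvd i \<longrightarrow> fps_nth f i = 0"
    and "convergent_fps v f"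
  shows "linearizable v f"
proof -
  interpret absolute_value v by fact
  have char: "CHAR('a) > 0"
    using assms(1,2) by simp
  have lam: "\<forall>n>0. (f $ 1) ^ n \<noteq> 1" "v (f $ 1) = 1" "f $ 1 \<noteq> 0"
    using assms(6,7,9) eq_0_iff[of lam] by auto
  obtain A where A: "1 \<le> A" "\<And>n. v (f $ n) * A \<le> A ^ n"
    using convergent_fps_bound[OF assms(11,8)] lam(2) by auto
  obtain \<delta> where \<delta>: "0 < \<delta>" "\<delta> \<le> 1" "\<And>n. \<not> CHAR('a) dvd n \<Longrightarrow> \<delta> \<le> v ((f $ 1) ^ n - 1)"
    using value_power_diff_1_bounded_below[OF char lam(1)] by blast
  let ?g = "Abs_fps (schroeder_coeff f)" and ?B = "A / \<delta>"
  have B: "1 \<le> ?B"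
    using A(1) \<delta>(1,2) by (simp add: field_simps)
  have "v (?g $ n) \<le> ?B ^ n" for n
  proof -
    have "v (?g $ n) * 1 \<le> v (?g $ n) * ?B"
      using B by (intro mult_left_mono nonneg)
    also have "\<dots> \<le> ?B ^ n"
      using schroeder_coeff_bound[OF char lam(2) A(1) \<delta>(1,2) A(2) \<delta>(3)] by simp
    finally show ?thesis by simp
  qed
  then have "convergent_fps v ?g"
    using B by (intro convergent_fpsI[of ?B]) simp_all
  moreover have "fps_compose ?g f = fps_const (f $ 1) * ?g"
    using assms(2,8,10) lam by (intro schroeder_equation) simp_all
  ultimately show ?thesis
    unfolding linearizable_def by (intro exI[of _ ?g]) simp
qed

end
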